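(* Let $S$ be a type-space functor with enough countable models (i.e. $S_{\mathcal W}$ dense in $S_\omega$) such that $S_{\mathcal W}$ is quasi-regular. Then the following are equivalent: (1) $S$ has the strong omitting types property; (2) $S_{\mathcal W}$ is completely non-meagre; (3) $S_{\mathcal W}$ is completely Baire.
   Context: Regard each natural number $n$ as the set $\{0,\dots,n-1\}$. A type-space functor $S$ assigns to each $n<\omega$ a topological space $S_n$ and to each function $f:n\to m$ a continuous open map $Sf:S_m\to S_n$ such that $S(g\circ f)=(Sf)\circ(Sg)$, $S(\mathrm{id}_n)=\mathrm{id}_{S_n}$, and a weak amalgamation condition holds (for every $m$, $p\in S_m$, $q\in(Si_m)^{-1}(\{p\})$ and non-empty open $U\subseteq(Si_m)^{-1}(\{p\})$ there is $r\in S_{m+2}$ with $(Si_{m+1})(r)=q$ and $(Sd_m)(r)\in U$, where $i_k:k\to k+1$ is the inclusion and $d_m(j)=j$ for $j<m$, $d_m(m)=m+1$). For $n\le m$, $\iota_{n,m}:n\to m$ is the inclusion. $S_\omega=\{(a_n)_{n<\omega}\in\prod_n S_n : a_n=(S\iota_{n,m})(a_m)\ \forall n<m\}$ with the product subspace topology; for $f:n\to\omega$, $Sf:S_\omega\to S_n$ is $(Sf)((a_j)_j)=(Sf')(a_m)$ where $f[n]\subseteq m$ and $f':n\to m$ agrees with $f$. A model of size $\omega$ for $S$ is a function $M$ on $[\omega]^{<\omega}$ such that for every $A=\{a_0<\dots<a_{n-1}\}\in[\omega]^n$: (1) $M(A)\in S_n$; (2) if $B=\{b_0<\dots<b_{m-1}\}\supseteq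 A$ and $g:n\to m$ satisfies $a_i=b_{g(i)}$ then $M(A)=(Sg)(M(B))$; (3) for every $m\ge n$ and open $U\subseteq(S\iota_{n,m})^{-1}(\{M(A)\})$ there are $B=\{b_0<\dots<b_{m-1}\}\in[\omega]^m$, $B\supseteq A$, and a permutation $g$ of $m$ with $a_i=b_{g(i)}$ for $i<n$ and $(Sg)(M(B))\in U$. For $\sigma\in S_\omega$, $M_\sigma(A)=(Sf_A)(\sigma)$ where $f_A:n\to\omega$ enumerates $A$ increasingly; $S_{\mathcal W}=\{\sigma\in S_\omega: M_\sigma\text{ is a model}\}$ with the subspace topology (its elements are identified with countable models). $S$ has the strong omitting types property if for every closed $C\subseteq S_\omega$ and every $E\subseteq C$ meagre in $C$ there is a model in $C$ omitting $E$, i.e. some $\sigma\in S_{\mathcal W}\cap C$ with $\sigma\notin E$. A space is quasi-regular if every non-empty open set includes the closure of a non-empty open set. A space is completely Baire if every closed subspace is Baire, and completely non-meagre if every closed subspace is non-meagre in itself.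
   Formalization: In the strong omitting types property, C ranges only over non-empty closed sets in which the models are dense (for arbitrary closed C the equivalence is false); U in clause (3) of a model, and the closed subspaces in "completely non-meagre", are taken non-empty. *)

theory Defs
  imports "HOL-Analysis.Analysis"
begin

subsection \<open>Baire category notions\<close>

definition nowhere_dense_in :: "'b topology \<Rightarrow> 'b set \<Rightarrow> bool" where
  "nowhere_dense_in X N \<longleftrightarrow> N \<subseteq> topspace X \<and> X interior_of (X closure_of N) = {}"

definition meagre_in :: "'b topology \<Rightarrow> 'b set \<Rightarrow> bool" where
  "meagre_in X A \<longleftrightarrow> (\<exists>N :: nat \<Rightarrow> 'b set. (\<forall>k. nowhere_dense_in X (N k)) \<and> A = (\<Union>k. N k))"

definition Baire_space :: "'b topology \<Rightarrow> bool" where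
  "Baire_space X \<longleftrightarrow>
     (\<forall>G :: nat \<Rightarrow> 'b set. (\<forall>k. openin X (G k) \<and> X closure_of (G k) = topspace X) \<longrightarrow>
        X closure_of (\<Inter>k. G k) = topspace X)"

definition completely_Baire :: "'b topology \<Rightarrow> bool" where
  "completely_Baire X \<longleftrightarrow> (\<forall>C. closedin X C \<longrightarrow> Baire_space (subtopology X C))"

text \<open>The empty subspace is always meagre in itself, so only non-empty closed subspaces count.\<close>

definition completely_nonmeagre :: "'b topology \<Rightarrow> bool" where
  "completely_nonmeagre X \<longleftrightarrow>
     (\<forall>C. closedin X C \<and> C \<noteq> {} \<longrightarrow> \<not> meagre_in (subtopology X C) C)"

definition quasi_regular :: "'b topology \<Rightarrow> bool" where
  "quasi_regular X \<longleftrightarrow>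
     (\<forall>U. openin X U \<and> U \<noteq> {} \<longrightarrow>
        (\<exists>V. openin X V \<and> V \<noteq> {} \<and> X closure_of V \<subseteq> U))"


subsection \<open>Type-space functors\<close>

text \<open>
  A function from n to m is an element of the extensional function space
  \<open>{..<n} \<rightarrow>\<^sub>E {..<m}\<close>.  The spaces \<open>S n\<close> are topologies on
  subsets of one common type, and \<open>F n m f\<close> is the map from \<open>S m\<close> to
  \<open>S n\<close> induced by \<open>f\<close>, relevant only for \<open>f\<close> from n to m and
  on the points of \<open>S m\<close>.
\<close>

type_synonym 'a action = "nat \<Rightarrow> nat \<Rightarrow> (nat \<Rightarrow> nat) \<Rightarrow> 'a \<Rightarrow> 'a"

definition incl :: "nat \<Rightarrow> nat \<Rightarrow> nat" where
  "incl n = (\<lambda>j\<in>{..<n}. j)"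

text \<open>The injection \<open>d\<^sub>m\<close> from \<open>m + 1\<close> to \<open>m + 2\<close> that omits the value m.\<close>

definition skip :: "nat \<Rightarrow> nat \<Rightarrow> nat" where
  "skip m = (\<lambda>j\<in>{..<m + 1}. if j < m then j else m + 1)"

definition fibre :: "(nat \<Rightarrow> 'a topology) \<Rightarrow> 'a action \<Rightarrow> nat \<Rightarrow> nat \<Rightarrow> 'a \<Rightarrow> 'a set" where
  "fibre S F n m p = {q \<in> topspace (S m). F n m (incl n) q = p}"

locale type_space_functor =
  fixes S :: "nat \<Rightarrow> 'a topology" and F :: "'a action"
  assumes continuous: "f \<in> {..<n} \<rightarrow>\<^sub>E {..<m} \<Longrightarrow> continuous_map (S m) (S n) (F n m f)"
    and "open": "f \<in> {..<n} \<rightarrow>\<^sub>E {..<m} \<Longrightarrow> open_map (S m) (S n) (F n m f)"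
    and comp: "\<lbrakk>f \<in> {..<n} \<rightarrow>\<^sub>E {..<m}; g \<in> {..<m} \<rightarrow>\<^sub>E {..<k}; p \<in> topspace (S k)\<rbrakk>
      \<Longrightarrow> F n k (compose {..<n} g f) p = F n m f (F m k g p)"
    and ident: "p \<in> topspace (S n) \<Longrightarrow> F n n (\<lambda>j\<in>{..<n}. j) p = p"
    and weak_amalgamation:
      "\<lbrakk>p \<in> topspace (S m); q \<in> fibre S F m (m + 1) p;
        openin (subtopology (S (m + 1)) (fibre S F m (m + 1) p)) U; U \<noteq> {}\<rbrakk>
      \<Longrightarrow> \<exists>r \<in> topspace (S (m + 2)).
            F (m + 1) (m + 2) (incl (m + 1)) r = q \<and> F (m + 1) (m + 2) (skip m) r \<in> U"

definition S_omega :: "(nat \<Rightarrow> 'a topology) \<Rightarrow> 'a action \<Rightarrow> (nat \<Rightarrow> 'a) topology" where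
  "S_omega S F =
     subtopology (product_topology S UNIV) {a. \<forall>n m. n < m \<longrightarrow> a n = F n m (incl n) (a m)}"

text \<open>
  The map from \<open>S\<^sub>\<omega>\<close> to \<open>S n\<close> induced by \<open>f\<close> from n to
  \<open>\<omega>\<close>, computed at the least bound for the range of \<open>f\<close>; by
  \<open>F_omega_eq\<close> below any bound gives the same value.
\<close>

definition F_omega :: "'a action \<Rightarrow> nat \<Rightarrow> (nat \<Rightarrow> nat) \<Rightarrow> (nat \<Rightarrow> 'a) \<Rightarrow> 'a" where
  "F_omega F n f a =
     (let m = (LEAST m. f ` {..<n} \<subseteq> {..<m}) in F n m (restrict f {..<n}) (a m))"

lemma (in type_space_functor) F_omega_eq:
  assumes a: "a \<in> topspace (S_omega S F)" and k: "f ` {..<n} \<subseteq> {..<k}"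
  shows "F_omega F n f a = F n k (restrict f {..<n}) (a k)"
proof -
  define m where "m = (LEAST m. f ` {..<n} \<subseteq> {..<m})"
  have m: "f ` {..<n} \<subseteq> {..<m}" and "m \<le> k"
    unfolding m_def using k by (rule LeastI, intro Least_le)
  have ak: "a k \<in> topspace (S k)"
    using a by (auto simp: S_omega_def)
  show ?thesis
  proof (cases "m = k")
    case True
    then show ?thesis
      by (simp add: F_omega_def m_def Let_def)
  next
    case False
    then have "m < k"
      using \<open>m \<le> k\<close> by simp
    have am: "a m = F m k (incl m) (a k)"
      using a \<open>m < k\<close> by (auto simp: S_omega_def)
    have f: "restrict f {..<n} \<in> {..<n} \<rightarrow>\<^sub>E {..<m}"
      using m by (auto simp: PiE_iff)
    have i: "incl m \<in> {..<m} \<rightarrow>\<^sub>E {..<k}"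
      using \<open>m < k\<close> by (auto simp: incl_def)
    have "compose {..<n} (incl m) (restrict f {..<n}) = restrict f {..<n}"
      using m by (auto simp: compose_def incl_def fun_eq_iff)
    then have "F n m (restrict f {..<n}) (a m) = F n k (restrict f {..<n}) (a k)"
      using comp[OF f i ak] am by simp
    then show ?thesis
      by (simp add: F_omega_def m_def Let_def)
  qed
qed


subsection \<open>Countable models\<close>

definition enum :: "nat set \<Rightarrow> nat \<Rightarrow> nat" where
  "enum A = (\<lambda>i\<in>{..<card A}. sorted_list_of_set A ! i)"

text \<open>
  Only the values of \<open>M\<close> on finite sets matter.  In the last clause \<open>U\<close> has to be
  non-empty, since otherwise the clause could never be satisfied.
\<close>

definition is_model :: "(nat \<Rightarrow> 'a topology) \<Rightarrow> 'a action \<Rightarrow> (nat set \<Rightarrow> 'a) \<Rightarrow> bool" where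
  "is_model S F M \<longleftrightarrow>
     (\<forall>A. finite A \<longrightarrow>
        M A \<in> topspace (S (card A)) \<and>
        (\<forall>B g. finite B \<and> A \<subseteq> B \<and> g \<in> {..<card A} \<rightarrow>\<^sub>E {..<card B} \<and>
            (\<forall>i<card A. enum A i = enum B (g i)) \<longrightarrow>
          M A = F (card A) (card B) g (M B)) \<and>
        (\<forall>m U. card A \<le> m \<and> U \<noteq> {} \<and>
            openin (subtopology (S m) (fibre S F (card A) m (M A))) U \<longrightarrow>
          (\<exists>B g. finite B \<and> card B = m \<and> A \<subseteq> B \<and>
             g \<in> {..<m} \<rightarrow>\<^sub>E {..<m} \<and> bij_betw g {..<m} {..<m} \<and>
             (\<forall>i<card A. enum A i = enum B (g i)) \<and>
             F m m g (M B) \<in> U)))"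

definition model_of :: "'a action \<Rightarrow> (nat \<Rightarrow> 'a) \<Rightarrow> nat set \<Rightarrow> 'a" where
  "model_of F \<sigma> A = F_omega F (card A) (enum A) \<sigma>"

definition models :: "(nat \<Rightarrow> 'a topology) \<Rightarrow> 'a action \<Rightarrow> (nat \<Rightarrow> 'a) set" where
  "models S F = {\<sigma> \<in> topspace (S_omega S F). is_model S F (model_of F \<sigma>)}"

definition S_W :: "(nat \<Rightarrow> 'a topology) \<Rightarrow> 'a action \<Rightarrow> (nat \<Rightarrow> 'a) topology" where
  "S_W S F = subtopology (S_omega S F) (models S F)"

definition enough_countable_models :: "(nat \<Rightarrow> 'a topology) \<Rightarrow> 'a action \<Rightarrow> bool" where
  "enough_countable_models S F \<longleftrightarrow>
     S_omega S F closure_of models S F = topspace (S_omega S F)"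

text \<open>
  The closed sets \<open>C\<close> that matter are the non-empty ones having enough models of their own, in
  that the models in \<open>C\<close> are dense in \<open>C\<close>.  A closed set containing no model has no
  model omitting the empty set, and more generally the models in \<open>C\<close> may form a nowhere dense
  subset of \<open>C\<close> when they are not dense.
\<close>

definition strong_omitting_types :: "(nat \<Rightarrow> 'a topology) \<Rightarrow> 'a action \<Rightarrow> bool" where
  "strong_omitting_types S F \<longleftrightarrow>
     (\<forall>C E. closedin (S_omega S F) C \<and> C \<noteq> {} \<and>
        subtopology (S_omega S F) C closure_of (models S F \<inter> C) = C \<and>
        E \<subseteq> C \<and> meagre_in (subtopology (S_omega S F) C) E \<longrightarrow>
        (\<exists>\<sigma> \<in> models S F \<inter> C. \<sigma> \<notin> E))"

end

theory Submission
  imports Defs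
begin

text \<open>
  All of this is general topology for a subspace W of a space X, here the models in
  \<open>S\<^sub>\<omega>\<close>.  Nowhere density of a subset of D is the same in D as in any space in
  which D is dense; applied to a closed C in which \<open>W \<inter> C\<close> is dense, this makes (1) and (2)
  equivalent.  For (2) implies (3), a closed subspace K that is not Baire has a non-empty open
  subset U that is meagre in K.  The closure of U is then the union of U and of the boundary of U,
  both meagre in it, so it is a non-empty closed set that is meagre in itself.
\<close>

section \<open>Nowhere dense sets and passage to subspaces\<close>

text \<open>This form avoids closures, so it passes to subspaces by intersecting open sets. One
  direction shrinks \<open>U\<close> by removing the closure of \<open>N\<close>; the other uses
  that an open set missing \<open>N\<close> also misses its closure.\<close>

lemma nowhere_dense_in_iff:
  "nowhere_dense_in X N \<longleftrightarrow> N \<subseteq> topspace X \<and>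
     (\<forall>U. openin X U \<and> U \<noteq> {} \<longrightarrow> (\<exists>V. openin X V \<and> V \<noteq> {} \<and> V \<subseteq> U \<and> V \<inter> N = {}))"
    (is "_ \<longleftrightarrow> _ \<and> ?R")
proof (cases "N \<subseteq> topspace X")
  case True
  have "X interior_of (X closure_of N) = {} \<longleftrightarrow> ?R"
  proof
    assume L: "X interior_of (X closure_of N) = {}"
    show ?R
    proof (intro allI impI)
      fix U assume U: "openin X U \<and> U \<noteq> {}"
      have "\<not> U \<subseteq> X closure_of N"
        using L U interior_of_maximal[of U "X closure_of N" X] by auto
      then have "U - X closure_of N \<noteq> {}" by blast
      moreover have "openin X (U - X closure_of N)"
        using U by (simp add: openin_diff)
      moreover have "(U - X closure_of N) \<inter> N = {}"
        using closure_of_subset[OF True] by blast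
      ultimately show "\<exists>V. openin X V \<and> V \<noteq> {} \<and> V \<subseteq> U \<and> V \<inter> N = {}"
        by blast
    qed
  next
    assume R: ?R
    show "X interior_of (X closure_of N) = {}"
    proof (rule ccontr)
      assume "X interior_of (X closure_of N) \<noteq> {}"
      then obtain V where V: "openin X V" "V \<noteq> {}" "V \<subseteq> X interior_of (X closure_of N)"
        "V \<inter> N = {}"
        using R openin_interior_of by meson
      then have "V \<inter> X closure_of N = {}"
        using openin_Int_closure_of_eq_empty by blast
      then show False
        using V interior_of_subset[of X "X closure_of N"] by blast
    qed
  qed
  then show ?thesis
    using True by (simp add: nowhere_dense_in_def)
qed (simp add: nowhere_dense_in_def)

text \<open>Open subsets of \<open>D\<close> are open in \<open>X\<close>, so the witness found in
  \<open>X\<close> below such a set already lies in \<open>D\<close>.\<close>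

lemma nowhere_dense_in_subtopology_open:
  assumes N: "nowhere_dense_in X N" and D: "openin X D"
  shows "nowhere_dense_in (subtopology X D) (N \<inter> D)"
  unfolding nowhere_dense_in_iff
proof (intro conjI allI impI)
  show "N \<inter> D \<subseteq> topspace (subtopology X D)"
    using N by (auto simp: nowhere_dense_in_def)
next
  fix U assume "openin (subtopology X D) U \<and> U \<noteq> {}"
  then have "openin X U" "U \<noteq> {}" "U \<subseteq> D"
    using D by (auto simp: openin_open_subtopology)
  then obtain V where "openin X V" "V \<noteq> {}" "V \<subseteq> U" "V \<inter> N = {}"
    using N unfolding nowhere_dense_in_iff by metis
  with D \<open>U \<subseteq> D\<close>
  show "\<exists>V. openin (subtopology X D) V \<and> V \<noteq> {} \<and> V \<subseteq> U \<and> V \<inter> (N \<inter> D) = {}"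
    by (intro exI[of _ V]) (auto simp: openin_open_subtopology)
qed

text \<open>The witness \<open>V\<close> found in \<open>X\<close> need not lie in \<open>D\<close>,
  but its trace \<open>V \<inter> D\<close> is non-empty because \<open>D\<close> is dense.\<close>

lemma nowhere_dense_in_subtopology_dense:
  assumes N: "nowhere_dense_in X N" and D: "X closure_of D = topspace X"
  shows "nowhere_dense_in (subtopology X D) (N \<inter> D)"
  unfolding nowhere_dense_in_iff
proof (intro conjI allI impI)
  show "N \<inter> D \<subseteq> topspace (subtopology X D)"
    using N by (auto simp: nowhere_dense_in_def)
next
  fix U assume "openin (subtopology X D) U \<and> U \<noteq> {}"
  then obtain T where T: "openin X T" "U = T \<inter> D" "T \<noteq> {}"
    by (auto simp: openin_subtopology)
  then obtain V where V: "openin X V" "V \<noteq> {}" "V \<subseteq> T" "V \<inter> N = {}"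
    using N unfolding nowhere_dense_in_iff by metis
  then have "V \<inter> D \<noteq> {}"
    using D by (metis dense_intersects_open Int_commute)
  with V T show "\<exists>V. openin (subtopology X D) V \<and> V \<noteq> {} \<and> V \<subseteq> U \<and> V \<inter> (N \<inter> D) = {}"
    by (intro exI[of _ "V \<inter> D"]) (auto simp: openin_subtopology)
qed

lemma nowhere_dense_in_superspace:
  assumes N: "nowhere_dense_in (subtopology X D) N" and D: "X closure_of D = topspace X"
  shows "nowhere_dense_in X N"
  unfolding nowhere_dense_in_iff
proof (intro conjI allI impI)
  show "N \<subseteq> topspace X"
    using N by (auto simp: nowhere_dense_in_def)
next
  fix U assume U: "openin X U \<and> U \<noteq> {}"
  then have "U \<inter> D \<noteq> {}"
    using D by (metis dense_intersects_open Int_commute)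
  moreover have "openin (subtopology X D) (U \<inter> D)"
    using U by (auto simp: openin_subtopology)
  ultimately obtain V where V: "openin (subtopology X D) V" "V \<noteq> {}" "V \<subseteq> U \<inter> D" "V \<inter> N = {}"
    using N unfolding nowhere_dense_in_iff by metis
  then obtain T where T: "openin X T" "V = T \<inter> D"
    by (auto simp: openin_subtopology)
  have "N \<subseteq> D"
    using N by (auto simp: nowhere_dense_in_def)
  with U V T show "\<exists>V. openin X V \<and> V \<noteq> {} \<and> V \<subseteq> U \<and> V \<inter> N = {}"
    by (intro exI[of _ "T \<inter> U"]) auto
qed

lemma nowhere_dense_in_complement_of_open_dense:
  assumes "openin X G" "X closure_of G = topspace X"
  shows "nowhere_dense_in X (topspace X - G)"
proof -
  have "X closure_of (topspace X - G) = topspace X - G"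
    using assms by (simp add: closure_of_eq closedin_def double_diff openin_subset)
  then show ?thesis
    using assms by (simp add: nowhere_dense_in_def interior_of_complement)
qed

section \<open>Baire spaces and meagre closed subspaces\<close>

text \<open>If nowhere dense sets covered the space, the complements of their closures would be
  dense open sets with empty intersection, and the empty set is not dense in a non-empty
  space.\<close>

lemma nonmeagre_if_Baire_space:
  assumes "Baire_space X" "topspace X \<noteq> {}"
  shows "\<not> meagre_in X (topspace X)"
proof
  assume "meagre_in X (topspace X)"
  then obtain N :: "nat \<Rightarrow> 'a set"
    where N: "\<And>k. nowhere_dense_in X (N k)" and eq: "topspace X = (\<Union>k. N k)"
    by (auto simp: meagre_in_def)
  define G where "G k = topspace X - X closure_of N k" for k
  have "openin X (G k) \<and> X closure_of (G k) = topspace X" for k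
    using N[of k] by (simp add: G_def nowhere_dense_in_def openin_diff closure_of_complement)
  then have "X closure_of (\<Inter>k. G k) = topspace X"
    using assms(1) by (simp add: Baire_space_def)
  moreover have "(\<Inter>k. G k) = {}"
  proof -
    have "N k \<subseteq> X closure_of N k" for k
      using N[of k] by (simp add: nowhere_dense_in_def closure_of_subset)
    then show ?thesis
      unfolding G_def using eq by blast
  qed
  ultimately show False
    using assms(2) by simp
qed

lemma completely_Baire_imp_completely_nonmeagre:
  assumes "completely_Baire X"
  shows "completely_nonmeagre X"
  unfolding completely_nonmeagre_def
proof (intro allI impI)
  fix C assume C: "closedin X C \<and> C \<noteq> {}"
  then have "topspace (subtopology X C) = C"
    using closedin_subset by (metis topspace_subtopology_subset)
  then show "\<not> meagre_in (subtopology X C) C"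
    using nonmeagre_if_Baire_space[of "subtopology X C"] assms C
    by (auto simp: completely_Baire_def)
qed

lemma not_Baire_space_imp_meagre_closure:
  assumes "\<not> Baire_space X"
  obtains U where "openin X U" "U \<noteq> {}"
    "meagre_in (subtopology X (X closure_of U)) (X closure_of U)"
proof -
  obtain G :: "nat \<Rightarrow> 'a set"
    where G: "\<And>k. openin X (G k)" "\<And>k. X closure_of (G k) = topspace X"
      and nd: "X closure_of (\<Inter>k. G k) \<noteq> topspace X"
    using assms unfolding Baire_space_def by blast
  \<comment> \<open>As the intersection of the \<open>G k\<close> is not dense, some non-empty open
    set misses it.\<close>
  obtain U where U: "openin X U" "U \<noteq> {}" "U \<inter> (\<Inter>k. G k) = {}"
    using nd by (metis dense_intersects_open Int_commute)
  define K where "K = X closure_of U"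
  define Y where "Y = subtopology X K"
  have UK: "U \<subseteq> K" and K: "K \<subseteq> topspace X"
    using U(1) by (simp_all add: K_def closure_of_subset openin_subset closure_of_subset_topspace)
  have YU: "subtopology Y U = subtopology X U"
    using UK by (simp add: Y_def subtopology_subtopology Int_absorb1)
  have topY: "topspace Y = K"
    using K by (auto simp: Y_def)
  have dense: "Y closure_of U = topspace Y"
    using UK unfolding topY by (simp add: Y_def closure_of_subtopology Int_absorb1 flip: K_def)
  have openU: "openin Y U"
    using U(1) UK by (auto simp: Y_def openin_subtopology)
  \<comment> \<open>Index 0 takes the boundary of \<open>U\<close>. Index \<open>Suc j\<close> takes
    the points of \<open>U\<close> outside \<open>G j\<close>; these pieces cover \<open>U\<close>
    because \<open>U\<close> misses the intersection.\<close>
  define N where "N k = (case k of 0 \<Rightarrow> K - U | Suc j \<Rightarrow> (topspace X - G j) \<inter> U)" for k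
  have "nowhere_dense_in Y (N k)" for k
  proof (cases k)
    case 0
    then show ?thesis
      using nowhere_dense_in_complement_of_open_dense[OF openU dense] by (simp add: N_def topY)
  next
    case (Suc j)
    \<comment> \<open>\<open>U\<close> is open in \<open>X\<close>, so smallness of the complement
      of \<open>G j\<close> restricts to \<open>U\<close>; it then lifts to \<open>Y\<close>, where
      \<open>U\<close> is dense.\<close>
    have "nowhere_dense_in (subtopology Y U) ((topspace X - G j) \<inter> U)"
      unfolding YU
      by (intro nowhere_dense_in_subtopology_open nowhere_dense_in_complement_of_open_dense G U)
    then show ?thesis
      using nowhere_dense_in_superspace[OF _ dense] Suc by (simp add: N_def)
  qed
  moreover have "K = (\<Union>k. N k)"
  proof
    show "(\<Union>k. N k) \<subseteq> K"
      using UK by (auto simp: N_def split: nat.splits)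
    show "K \<subseteq> (\<Union>k. N k)"
    proof
      fix x assume "x \<in> K"
      show "x \<in> (\<Union>k. N k)"
      proof (cases "x \<in> U")
        case True
        then obtain j where "x \<notin> G j" using U(3) by blast
        then have "x \<in> N (Suc j)"
          using True \<open>x \<in> K\<close> K by (auto simp: N_def)
        then show ?thesis by blast
      next
        case False
        then have "x \<in> N 0" using \<open>x \<in> K\<close> by (simp add: N_def)
        then show ?thesis by blast
      qed
    qed
  qed
  ultimately have "meagre_in Y K"
    unfolding meagre_in_def by blast
  then show ?thesis
    using that U by (simp add: Y_def K_def)
qed

lemma completely_nonmeagre_imp_completely_Baire:
  assumes "completely_nonmeagre X"
  shows "completely_Baire X"
  unfolding completely_Baire_def
proof (intro allI impI)
  fix C assume C: "closedin X C"
  show "Baire_space (subtopology X C)"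
  proof (rule ccontr)
    assume "\<not> Baire_space (subtopology X C)"
    then obtain U where U: "openin (subtopology X C) U" "U \<noteq> {}"
      and meagre: "meagre_in (subtopology (subtopology X C) (subtopology X C closure_of U))
        (subtopology X C closure_of U)"
      by (rule not_Baire_space_imp_meagre_closure)
    let ?K = "subtopology X C closure_of U"
    \<comment> \<open>The hypothesis speaks of closed subsets of \<open>X\<close>, so the closure
      taken inside \<open>C\<close> must be closed in \<open>X\<close> as well.\<close>
    have "closedin X ?K"
      using C closedin_closure_of closedin_trans_full by metis
    moreover have "U \<subseteq> ?K"
      using U(1) by (intro closure_of_subset openin_subset)
    moreover have "subtopology (subtopology X C) ?K = subtopology X ?K"
      using closure_of_subset_subtopology[of X C U]
      by (simp only: subtopology_subtopology Int_absorb1)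
    ultimately show False
      using assms U(2) meagre unfolding completely_nonmeagre_def by (metis subset_empty)
  qed
qed

section \<open>Omitting meagre sets within a subspace\<close>

text \<open>Closed sets \<open>K\<close> of the subspace \<open>W\<close> correspond to closed sets
  \<open>C\<close> of \<open>X\<close> in which \<open>W \<inter> C\<close> is dense, by closure and
  by trace on \<open>W\<close>. Meagreness transfers between \<open>C\<close> and its dense subspace
  \<open>K\<close>.\<close>

lemma omitting_meagre_iff_completely_nonmeagre:
  assumes W: "W \<subseteq> topspace X"
  shows "(\<forall>C E. closedin X C \<and> C \<noteq> {} \<and> subtopology X C closure_of (W \<inter> C) = C \<and>
            E \<subseteq> C \<and> meagre_in (subtopology X C) E \<longrightarrow> (\<exists>x \<in> W \<inter> C. x \<notin> E)) \<longleftrightarrow>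
         completely_nonmeagre (subtopology X W)" (is "?L \<longleftrightarrow> ?R")
proof
  assume L: ?L
  show ?R
    unfolding completely_nonmeagre_def
  proof (intro allI impI notI)
    fix K assume "closedin (subtopology X W) K \<and> K \<noteq> {}"
      and "meagre_in (subtopology (subtopology X W) K) K"
    then have closed: "closedin (subtopology X W) K" and "K \<noteq> {}"
      and meagre: "meagre_in (subtopology (subtopology X W) K) K" by auto
    define C where "C = X closure_of K"
    have KW: "K \<subseteq> W"
      using closedin_subset[OF closed] by simp
    have WC: "W \<inter> C = K"
      using closure_of_closedin[OF closed] KW
      by (simp add: C_def closure_of_subtopology Int_absorb1)
    have KC: "K \<subseteq> C"
      using WC by blast
    have CX: "C \<subseteq> topspace X"
      unfolding C_def by (rule closure_of_subset_topspace)
    have dense: "subtopology X C closure_of K = C"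
      using KC by (simp add: closure_of_subtopology Int_absorb1) (simp add: C_def)
    have sub: "subtopology (subtopology X C) K = subtopology (subtopology X W) K"
      using KC KW by (simp add: subtopology_subtopology Int_absorb1)
    have "nowhere_dense_in (subtopology X C) N"
      if "nowhere_dense_in (subtopology (subtopology X W) K) N" for N
      using nowhere_dense_in_superspace[of "subtopology X C" K N] that dense CX
      by (simp add: sub Int_absorb1)
    \<comment> \<open>With \<open>E = K = W \<inter> C\<close> there is no point of \<open>W\<close>
      in \<open>C\<close> left to omit \<open>E\<close>.\<close>
    then have "meagre_in (subtopology X C) K"
      using meagre unfolding meagre_in_def by metis
    moreover have "closedin X C" "C \<noteq> {}"
      using \<open>K \<noteq> {}\<close> KC by (auto simp: C_def)
    ultimately show False
      using L[rule_format, of C K] dense KC WC by auto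
  qed
next
  assume R: ?R
  show ?L
  proof (intro allI impI)
    fix C E
    assume "closedin X C \<and> C \<noteq> {} \<and> subtopology X C closure_of (W \<inter> C) = C \<and>
      E \<subseteq> C \<and> meagre_in (subtopology X C) E"
    then have closed: "closedin X C" and "C \<noteq> {}"
      and dense: "subtopology X C closure_of (W \<inter> C) = C"
      and meagre: "meagre_in (subtopology X C) E" by auto
    have CX: "C \<subseteq> topspace X"
      using closed by (rule closedin_subset)
    let ?K = "W \<inter> C"
    have sub: "subtopology (subtopology X C) ?K = subtopology (subtopology X W) ?K"
      by (simp add: subtopology_subtopology Int_left_absorb Int_ac)
    obtain N :: "nat \<Rightarrow> 'a set"
      where N: "\<And>k. nowhere_dense_in (subtopology X C) (N k)" and E: "E = (\<Union>k. N k)"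
      using meagre by (auto simp: meagre_in_def)
    have "nowhere_dense_in (subtopology (subtopology X W) ?K) (N k \<inter> ?K)" for k
      using nowhere_dense_in_subtopology_dense[OF N, of ?K] dense CX by (simp add: sub Int_absorb1)
    then have "meagre_in (subtopology (subtopology X W) ?K) (E \<inter> ?K)"
      unfolding meagre_in_def E by (intro exI[of _ "\<lambda>k. N k \<inter> ?K"]) auto
    \<comment> \<open>An empty trace would have empty closure, whereas its closure in
      \<open>C\<close> is the non-empty set \<open>C\<close>.\<close>
    moreover have "?K \<noteq> {}"
      using dense \<open>C \<noteq> {}\<close> by auto
    moreover have "closedin (subtopology X W) ?K"
      using closed by (auto simp: closedin_subtopology)
    \<comment> \<open>The trace of \<open>E\<close> is meagre in \<open>?K\<close>, which is not
      meagre in itself; so some point of \<open>?K\<close> escapes \<open>E\<close>.\<close>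
    ultimately have "E \<inter> ?K \<noteq> ?K"
      using R unfolding completely_nonmeagre_def by metis
    then show "\<exists>x \<in> ?K. x \<notin> E"
      by blast
  qed
qed

theorem theorem2p2:
  fixes S :: "nat \<Rightarrow> 'a topology" and F :: "'a action"
  assumes "type_space_functor S F"
    and "enough_countable_models S F"
    and "quasi_regular (S_W S F)"
  shows "(strong_omitting_types S F \<longleftrightarrow> completely_nonmeagre (S_W S F)) \<and>
         (completely_nonmeagre (S_W S F) \<longleftrightarrow> completely_Baire (S_W S F))"
proof
  have "models S F \<subseteq> topspace (S_omega S F)"
    by (auto simp: models_def)
  \<comment> \<open>The general equivalence is used with \<open>S_omega S F\<close> as the space and
    the models as \<open>W\<close>.\<close>
  then show "strong_omitting_types S F \<longleftrightarrow> completely_nonmeagre (S_W S F)"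
    unfolding strong_omitting_types_def S_W_def
    by (rule omitting_meagre_iff_completely_nonmeagre)
  show "completely_nonmeagre (S_W S F) \<longleftrightarrow> completely_Baire (S_W S F)"
    using completely_Baire_imp_completely_nonmeagre completely_nonmeagre_imp_completely_Baire
    by blast
qed

end
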